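(* Let $f(z)=h(z)+\overline{g(z)}=\sum_{k=0}^{\infty}a_kz^k+\overline{\sum_{k=1}^{\infty}b_kz^k}$ be harmonic in $\mathbb{D}$. Let $\{n_p\}_{p=1}^{\infty}$ be a strictly increasing sequence of nonnegative integers such that for every $p$ $$\frac{f^{(n_p)}-n_p!\,a_{n_p}-n_p!\,\overline{b_{n_p}}}{(n_p+1)!\,a_{n_p+1}}\in\mathcal{S}_H^{c}\quad\text{if }|a_{n_p+1}|\ge|b_{n_p+1}|,$$ and $$\frac{\overline{f^{(n_p)}}-n_p!\,\overline{a_{n_p}}-n_p!\,b_{n_p}}{(n_p+1)!\,b_{n_p+1}}\in\mathcal{S}_H^{c}\quad\text{if }|a_{n_p+1}|\le|b_{n_p+1}|.$$ Let $\lambda=\liminf_{p\to\infty}\frac{n_p}{n_{p+1}}$. Then: (1) If $\lambda=1$, then $R_f=\infty$, i.e. $f$ is entire. (2) If $0<\lambda<1$, then $R_f\ge\lambda^{\frac{\lambda}{\lambda-1}}/(1-\lambda)$. (3) If $\lambda=0$, then $R_f\ge1$.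
   Context: Let $\mathbb{D}=\{z\in\mathbb{C}:|z|<1\}$. A harmonic mapping $F=H+\overline{G}$ ($H,G$ analytic) is sense-preserving if $G'=\omega H'$ for some analytic $\omega$ with $|\omega|<1$ and $F$ is nonconstant. $\mathcal{S}_H$ is the class of all univalent (injective) sense-preserving harmonic mappings $F=H+\overline{G}$ in $\mathbb{D}$ with $H(z)=z+\sum_{n=2}^{\infty}A_nz^n$ and $G(z)=\sum_{n=1}^{\infty}B_nz^n$. $\mathcal{S}_H^{c}$ is the family of $F\in\mathcal{S}_H$ whose coefficients satisfy $|A_n|<\frac{2n^2+1}{3}$ and $|B_n|<\frac{2n^2+1}{3}$ for all $n\ge2$. For $n\ge0$, $f^{(n)}:=h^{(n)}+\overline{g^{(n)}}$ (with $f^{(0)}=f$), and $b_0=0$. $R_f=\min\{R_h,R_g\}$, where $R_h,R_g$ are the radii of convergence of the power series of $h$ and $g$ about $0$. $f$ is (harmonic) entire if it extends to a harmonic function on $\mathbb{C}$. *)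

theory Defs
  imports "HOL-Complex_Analysis.Complex_Analysis"
begin

abbreviation unit_disc :: "complex set" where
  "unit_disc \<equiv> ball 0 1"

text \<open>
  On the simply connected domains used here (the unit disc and the plane), the complex-valued
  harmonic functions are exactly the sums of an analytic and a conjugated analytic function.
  The values of \<open>F\<close> outside \<open>S\<close> are irrelevant in everything that follows.
\<close>

definition harmonic_decomp ::
  "complex set \<Rightarrow> (complex \<Rightarrow> complex) \<Rightarrow> (complex \<Rightarrow> complex) \<Rightarrow> (complex \<Rightarrow> complex) \<Rightarrow> bool" where
  "harmonic_decomp S F H G \<longleftrightarrow>
     H holomorphic_on S \<and> G holomorphic_on S \<and> (\<forall>z\<in>S. F z = H z + cnj (G z))"

definition harmonic_fun_on :: "complex set \<Rightarrow> (complex \<Rightarrow> complex) \<Rightarrow> bool" where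
  "harmonic_fun_on S F \<longleftrightarrow> (\<exists>H G. harmonic_decomp S F H G)"

definition harmonic_entire :: "(complex \<Rightarrow> complex) \<Rightarrow> bool" where
  "harmonic_entire f \<longleftrightarrow> (\<exists>F. harmonic_fun_on UNIV F \<and> (\<forall>z\<in>unit_disc. F z = f z))"

definition sense_preserving_on ::
  "complex set \<Rightarrow> (complex \<Rightarrow> complex) \<Rightarrow> (complex \<Rightarrow> complex) \<Rightarrow> (complex \<Rightarrow> complex) \<Rightarrow> bool" where
  "sense_preserving_on S F H G \<longleftrightarrow>
     (\<exists>w. w holomorphic_on S \<and> (\<forall>z\<in>S. cmod (w z) < 1 \<and> deriv G z = w z * deriv H z))
     \<and> \<not> F constant_on S"

text \<open>
  The normalisation \<open>G 0 = B 0 = 0\<close> makes the decomposition of \<open>F\<close>, and hence the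
  coefficient sequences \<open>A\<close> and \<open>B\<close>, unique.
\<close>

definition S_H_expansion ::
  "(complex \<Rightarrow> complex) \<Rightarrow> (nat \<Rightarrow> complex) \<Rightarrow> (nat \<Rightarrow> complex) \<Rightarrow> bool" where
  "S_H_expansion F A B \<longleftrightarrow>
     (\<exists>H G. harmonic_decomp unit_disc F H G
          \<and> sense_preserving_on unit_disc F H G
          \<and> inj_on F unit_disc
          \<and> (\<forall>z\<in>unit_disc. (\<lambda>n. A n * z ^ n) sums H z)
          \<and> (\<forall>z\<in>unit_disc. (\<lambda>n. B n * z ^ n) sums G z)
          \<and> A 0 = 0 \<and> A 1 = 1 \<and> B 0 = 0)"

definition S_H :: "(complex \<Rightarrow> complex) set" where
  "S_H = {F. \<exists>A B. S_H_expansion F A B}"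

definition S_H_c :: "(complex \<Rightarrow> complex) set" where
  "S_H_c = {F \<in> S_H. \<exists>A B. S_H_expansion F A B \<and>
     (\<forall>n\<ge>2. cmod (A n) < (2 * real n ^ 2 + 1) / 3 \<and> cmod (B n) < (2 * real n ^ 2 + 1) / 3)}"

definition harmonic_deriv ::
  "(complex \<Rightarrow> complex) \<Rightarrow> (complex \<Rightarrow> complex) \<Rightarrow> nat \<Rightarrow> complex \<Rightarrow> complex" where
  "harmonic_deriv h g n z = (deriv ^^ n) h z + cnj ((deriv ^^ n) g z)"

definition harmonic_radius :: "(nat \<Rightarrow> complex) \<Rightarrow> (nat \<Rightarrow> complex) \<Rightarrow> ereal" where
  "harmonic_radius a b = min (conv_radius a) (conv_radius b)"

end

theory Submission
  imports Defs "HOL-Real_Asymp.Real_Asymp"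
begin

text \<open>
  Write \<open>M m\<close> for the maximum of \<open>\<bar>a m\<bar>\<close> and \<open>\<bar>b m\<bar>\<close>. The two halves of a harmonic mapping are unique up to
  constants, so membership in \<open>S_H_c\<close> at \<open>N = n p\<close> says
  \<open>(N + k)! M (N + k) \<le> (2 k^2 + 1) / 3 * k! * (N + 1)! M (N + 1)\<close>. Chaining these from \<open>p\<close> to \<open>p + 1\<close>
  costs, up to a polynomial in \<open>d = n (p + 1) - n p\<close>, the factor \<open>1 / (N + d choose d)\<close>. By Stirling-type
  bounds this is at most \<open>exp (- d q(N / d))\<close> with \<open>q(t) = (t + 1) ln (t + 1) - t ln t\<close> increasing, and
  \<open>N \<ge> u (N + d)\<close> means \<open>N / d \<ge> u / (1 - u)\<close>, where \<open>exp (q(u / (1 - u)))\<close> is the claimed radius for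
  \<open>u\<close>. The polynomial is absorbed by an arbitrarily small loss in the base if \<open>d\<close> is large, and by
  \<open>(N + d choose d) \<ge> N + 1\<close> if \<open>d\<close> is small. Hence the radius is at least that for every \<open>u < lam\<close>; let
  \<open>u\<close> tend to \<open>lam\<close>.
\<close>

section \<open>Uniqueness of the two halves of a harmonic function\<close>

text \<open>The holomorphic function \<open>H - H'\<close> equals the conjugate of the holomorphic
  function \<open>G' - G\<close> on \<open>S\<close>. Its real derivative is therefore both complex
  linear and conjugate linear, hence zero.\<close>

lemma harmonic_decomp_deriv_unique:
  assumes "harmonic_decomp S F H G" "harmonic_decomp S F H' G'" "open S" "z \<in> S"
  shows "deriv H z = deriv H' z" "deriv G z = deriv G' z"
proof -
  let ?u = "\<lambda>w. H w - H' w" and ?v = "\<lambda>w. G' w - G w"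
  have hol: "H holomorphic_on S" "H' holomorphic_on S" "G holomorphic_on S" "G' holomorphic_on S"
    and eq: "\<And>w. w \<in> S \<Longrightarrow> H w + cnj (G w) = H' w + cnj (G' w)"
    using assms(1,2) unfolding harmonic_decomp_def by auto
  define p where "p = deriv H z - deriv H' z"
  define q where "q = deriv G' z - deriv G z"
  have d: "(H has_field_derivative deriv H z) (at z)" "(H' has_field_derivative deriv H' z) (at z)"
    "(G has_field_derivative deriv G z) (at z)" "(G' has_field_derivative deriv G' z) (at z)"
    using hol assms(3,4) holomorphic_derivI by blast+
  have "(?u has_field_derivative p) (at z)" "(?v has_field_derivative q) (at z)"
    unfolding p_def q_def by (intro DERIV_diff d)+
  then have u: "(?u has_derivative (\<lambda>h. p * h)) (at z)" and v: "(?v has_derivative (\<lambda>h. q * h)) (at z)"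
    by (simp_all add: has_field_derivative_def)
  have "((\<lambda>w. cnj (?v w)) has_derivative (\<lambda>h. cnj (q * h))) (at z)"
    using has_derivative_cnj[OF v] .
  moreover have "?u w = cnj (?v w)" if "w \<in> S" for w
    using eq[OF that] by (simp add: algebra_simps)
  ultimately have "(?u has_derivative (\<lambda>h. cnj (q * h))) (at z)"
    using has_derivative_transform_within_open[OF _ assms(3,4)] by (metis (no_types, lifting))
  from has_derivative_unique[OF u this] have e: "p * h = cnj (q * h)" for h
    by metis
  \<comment> \<open>At \<open>h = 1\<close> this reads \<open>p = cnj q\<close>, and at
    \<open>h = \<i>\<close> it reads \<open>p = - cnj q\<close>.\<close>
  have "p = 0" "q = 0"
    using e[of 1] e[of \<i>] by (auto simp: complex_eq_iff)
  then show "deriv H z = deriv H' z" "deriv G z = deriv G' z"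
    by (simp_all add: p_def q_def)
qed

lemma harmonic_decomp_higher_deriv_unique:
  assumes "harmonic_decomp S F H G" "harmonic_decomp S F H' G'" "open S" "z \<in> S" "k \<ge> 1"
  shows "(deriv ^^ k) H z = (deriv ^^ k) H' z" "(deriv ^^ k) G z = (deriv ^^ k) G' z"
proof -
  obtain j where k: "k = Suc j" using assms(5) by (cases k) auto
  have hol: "deriv H holomorphic_on S" "deriv H' holomorphic_on S"
    "deriv G holomorphic_on S" "deriv G' holomorphic_on S"
    using assms(1-3) unfolding harmonic_decomp_def by (auto intro: holomorphic_deriv)
  show "(deriv ^^ k) H z = (deriv ^^ k) H' z"
    unfolding k funpow_Suc_right o_def
    by (rule higher_deriv_transform_within_open[OF hol(1,2) assms(3,4)])
      (rule harmonic_decomp_deriv_unique(1)[OF assms(1-3)])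
  show "(deriv ^^ k) G z = (deriv ^^ k) G' z"
    unfolding k funpow_Suc_right o_def
    by (rule higher_deriv_transform_within_open[OF hol(3,4) assms(3,4)])
      (rule harmonic_decomp_deriv_unique(2)[OF assms(1-3)])
qed

section \<open>Coefficient bounds from membership in \<open>S_H_c\<close>\<close>

lemma higher_deriv_power_series_0:
  fixes f :: "complex \<Rightarrow> complex"
  assumes "\<And>z. z \<in> unit_disc \<Longrightarrow> (\<lambda>k. c k * z ^ k) sums f z"
  shows "(deriv ^^ k) f 0 = fact k * c k"
proof -
  have "eventually (\<lambda>z. z \<in> unit_disc) (nhds (0::complex))"
    by (intro eventually_nhds_in_open) auto
  then have "f has_fps_expansion Abs_fps c"
    by (intro has_fps_expansionI) (auto elim!: eventually_mono intro: assms)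
  from fps_nth_fps_expansion[OF this, of k] show ?thesis
    by (simp add: field_simps)
qed

text \<open>Besides the decomposition provided by \<open>S_H_c\<close>, the normalised derivative
  has an explicit one built from \<open>h\<close> and \<open>g\<close>. Derivatives of order at
  least 1 at 0 agree for both, which expresses \<open>A\<close> and \<open>B\<close> through
  \<open>a\<close> and \<open>b\<close>. The subtracted constant \<open>e\<close> is arbitrary, so
  the lemma also applies with the roles of \<open>h\<close> and \<open>g\<close> exchanged.\<close>

lemma S_H_c_coeff_bound:
  assumes hol: "h holomorphic_on unit_disc" "g holomorphic_on unit_disc"
    and h: "\<And>z. z \<in> unit_disc \<Longrightarrow> (\<lambda>k. a k * z ^ k) sums h z"
    and g: "\<And>z. z \<in> unit_disc \<Longrightarrow> (\<lambda>k. b k * z ^ k) sums g z"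
    and F: "(\<lambda>z. ((deriv ^^ n) h z + cnj ((deriv ^^ n) g z) - e)
                / (fact (n + 1) * a (n + 1))) \<in> S_H_c"
    and k: "k \<ge> 2"
  shows "fact (n + k) * cmod (a (n + k)) \<le> (2 * real k ^ 2 + 1) / 3 * fact k * (fact (n + 1) * cmod (a (n + 1)))"
    and "fact (n + k) * cmod (b (n + k)) \<le> (2 * real k ^ 2 + 1) / 3 * fact k * (fact (n + 1) * cmod (a (n + 1)))"
proof -
  define D :: complex where "D = fact (n + 1) * a (n + 1)"
  define F where "F = (\<lambda>z. ((deriv ^^ n) h z + cnj ((deriv ^^ n) g z) - e) / D)"
  define H' where "H' = (\<lambda>z. inverse D * (deriv ^^ n) h z)"
  \<comment> \<open>The constant \<open>- e / D\<close> is placed in the conjugated half.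
    \<open>G' 0\<close> may thus differ from 0, so coefficients are compared only from index 1
    on.\<close>
  define G' where "G' = (\<lambda>z. cnj (inverse D) * (deriv ^^ n) g z + cnj (- e / D))"
  have "F \<in> S_H_c" using F unfolding F_def D_def .
  then obtain A B where "S_H_expansion F A B"
    and bd: "cmod (A k) < (2 * real k ^ 2 + 1) / 3" "cmod (B k) < (2 * real k ^ 2 + 1) / 3"
    unfolding S_H_c_def using k by auto
  then obtain H G where dec: "harmonic_decomp unit_disc F H G"
    and A: "\<And>z. z \<in> unit_disc \<Longrightarrow> (\<lambda>k. A k * z ^ k) sums H z"
    and B: "\<And>z. z \<in> unit_disc \<Longrightarrow> (\<lambda>k. B k * z ^ k) sums G z" and A1: "A 1 = 1"
    unfolding S_H_expansion_def by auto
  have holn: "(deriv ^^ n) h holomorphic_on unit_disc" "(deriv ^^ n) g holomorphic_on unit_disc"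
    by (intro holomorphic_higher_deriv hol open_ball)+
  have dec': "harmonic_decomp unit_disc F H' G'"
    unfolding harmonic_decomp_def H'_def G'_def F_def
    by (auto intro!: holomorphic_intros holn simp: field_simps diff_divide_distrib add_divide_distrib)
  have dH': "(deriv ^^ j) H' 0 = inverse D * (fact (n + j) * a (n + j))" for j
  proof -
    have "(deriv ^^ j) H' 0 = inverse D * (deriv ^^ j) ((deriv ^^ n) h) 0"
      unfolding H'_def by (rule higher_deriv_cmult[OF holn(1)]) auto
    then show ?thesis
      using higher_deriv_power_series_0[OF h, of "n + j"] by (simp add: funpow_add add.commute)
  qed
  have dG': "(deriv ^^ j) G' 0 = cnj (inverse D) * (fact (n + j) * b (n + j))" if "j \<ge> 1" for j
  proof -
    have "(deriv ^^ j) G' 0 = (deriv ^^ j) (\<lambda>z. cnj (inverse D) * (deriv ^^ n) g z) 0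
        + (deriv ^^ j) (\<lambda>z. cnj (- e / D)) 0"
      unfolding G'_def by (rule higher_deriv_add[of _ unit_disc]) (auto intro!: holomorphic_intros holn)
    also have "(deriv ^^ j) (\<lambda>z. cnj (inverse D) * (deriv ^^ n) g z) 0
        = cnj (inverse D) * (deriv ^^ j) ((deriv ^^ n) g) 0"
      by (rule higher_deriv_cmult[OF holn(2)]) auto
    finally show ?thesis
      using higher_deriv_power_series_0[OF g, of "n + j"] that by (simp add: funpow_add add.commute)
  qed
  have cA: "fact j * A j = inverse D * (fact (n + j) * a (n + j))"
    and cB: "fact j * B j = cnj (inverse D) * (fact (n + j) * b (n + j))" if "j \<ge> 1" for j
    using harmonic_decomp_higher_deriv_unique[OF dec dec' open_ball, of 0 j] that
      higher_deriv_power_series_0[OF A] higher_deriv_power_series_0[OF B] dH' dG' by auto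
  \<comment> \<open>Division by zero yields 0, so \<open>D = 0\<close> would give
    \<open>A 1 = 0\<close>, against the normalisation \<open>A 1 = 1\<close>.\<close>
  have D: "D \<noteq> 0" using cA[of 1] A1 by auto
  have "fact (n + k) * cmod (a (n + k)) = cmod D * (fact k * cmod (A k))"
    using arg_cong[OF cA[of k], of "\<lambda>x. cmod (D * x)"] D k by (simp add: norm_mult norm_inverse)
  moreover have "fact (n + k) * cmod (b (n + k)) = cmod D * (fact k * cmod (B k))"
    using arg_cong[OF cB[of k], of "\<lambda>x. cmod (cnj D * x)"] D k by (simp add: norm_mult norm_inverse)
  moreover have "cmod D * (fact k * x) \<le> (2 * real k ^ 2 + 1) / 3 * fact k * (fact (n + 1) * cmod (a (n + 1)))"
    if "x < (2 * real k ^ 2 + 1) / 3" for x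
  proof -
    have "cmod D * (fact k * x) \<le> cmod D * (fact k * ((2 * real k ^ 2 + 1) / 3))"
      using that by (intro mult_left_mono) auto
    also have "\<dots> = (2 * real k ^ 2 + 1) / 3 * fact k * (fact (n + 1) * cmod (a (n + 1)))"
      by (simp add: D_def norm_mult del: fact_Suc)
    finally show ?thesis .
  qed
  ultimately show "fact (n + k) * cmod (a (n + k)) \<le> (2 * real k ^ 2 + 1) / 3 * fact k * (fact (n + 1) * cmod (a (n + 1)))"
    and "fact (n + k) * cmod (b (n + k)) \<le> (2 * real k ^ 2 + 1) / 3 * fact k * (fact (n + 1) * cmod (a (n + 1)))"
    using bd by auto
qed

section \<open>Stirling-type bounds and lower bounds for binomial coefficients\<close>

text \<open>The induction step amounts to \<open>(1 + 1/d)^(d+1) >= e\<close>.\<close>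

lemma fact_times_exp_le:
  assumes "d \<ge> 1"
  shows "fact d * exp (real d) \<le> exp 1 * real d * real d ^ d"
  using assms
proof (induction d rule: dec_induct)
  case (step d)
  \<comment> \<open>This is \<open>ln x <= x - 1\<close> at \<open>x = d / (d + 1)\<close>.\<close>
  have "inverse (real d + 1) \<le> ln (1 + 1 / real d)"
    using ln_le_minus_one[of "real d / (real d + 1)"] step.hyps by (simp add: ln_div field_simps)
  then have "1 \<le> real (Suc d) * ln (1 + 1 / real d)"
    by (simp add: field_simps)
  then have "exp 1 \<le> exp (real (Suc d) * ln (1 + 1 / real d))"
    by simp
  also have "\<dots> = (1 + 1 / real d) ^ Suc d"
    using step.hyps by (simp only: exp_of_nat_mult) (simp add: add_pos_nonneg)
  finally have *: "exp 1 * real d ^ Suc d \<le> real (Suc d) ^ Suc d"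
    using step.hyps by (simp add: power_divide field_simps flip: power_mult_distrib)
  have "fact (Suc d) * exp (real (Suc d)) = real (Suc d) * exp 1 * (fact d * exp (real d))"
    by (simp add: exp_add algebra_simps)
  also have "\<dots> \<le> real (Suc d) * exp 1 * (exp 1 * real d * real d ^ d)"
    using step.IH by (intro mult_left_mono) auto
  also have "\<dots> = exp 1 * real (Suc d) * (exp 1 * real d ^ Suc d)"
    by simp
  also have "\<dots> \<le> exp 1 * real (Suc d) * real (Suc d) ^ Suc d"
    using * by (intro mult_left_mono) auto
  finally show ?case .
qed simp

text \<open>The quotient \<open>m^m / m!\<close> grows by the factor \<open>(1 + 1/m)^m <= e\<close>
  from \<open>m\<close> to \<open>m + 1\<close>; \<open>d\<close> such steps lead from
  \<open>N\<close> to \<open>N + d\<close>.\<close>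

lemma power_self_times_fact_le:
  assumes "N \<ge> 1"
  shows "real (N + d) ^ (N + d) * fact N \<le> exp (real d) * real N ^ N * fact (N + d)"
proof (induction d)
  case (Suc d)
  let ?n = "N + d"
  have "(1 + 1 / real ?n) ^ ?n \<le> exp 1"
    using exp_ge_one_plus_x_over_n_power_n[of "?n" 1] assms by simp
  then have *: "real (Suc ?n) ^ ?n \<le> exp 1 * real ?n ^ ?n"
    using assms by (simp add: power_divide field_simps flip: power_mult_distrib)
  have "real (N + Suc d) ^ (N + Suc d) * fact N = real (Suc ?n) * fact N * real (Suc ?n) ^ ?n"
    by simp
  also have "\<dots> \<le> real (Suc ?n) * fact N * (exp 1 * real ?n ^ ?n)"
    using * by (intro mult_left_mono) auto
  also have "\<dots> = real (Suc ?n) * exp 1 * (real ?n ^ ?n * fact N)"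
    by simp
  also have "\<dots> \<le> real (Suc ?n) * exp 1 * (exp (real d) * real N ^ N * fact ?n)"
    using Suc.IH by (intro mult_left_mono) auto
  also have "\<dots> = exp (real (Suc d)) * real N ^ N * fact (N + Suc d)"
    by (simp add: exp_add algebra_simps)
  finally show ?case .
qed simp

text \<open>The radius of case (2) with a free parameter: the growth argument needs some
  \<open>u < lam\<close>, and \<open>lam\<close> itself is reached by continuity.\<close>

definition radius_bound :: "real \<Rightarrow> real" where
  "radius_bound u = u powr (u / (u - 1)) / (1 - u)"

lemma radius_bound_pos: "0 < u \<Longrightarrow> u < 1 \<Longrightarrow> radius_bound u > 0"
  by (simp add: radius_bound_def)

text \<open>After taking logarithms this is \<open>q t0 <= q t\<close> for \<open>t = N / d\<close>.
  The hypothesis on \<open>N\<close> says exactly \<open>t0 <= t\<close>, and \<open>q\<close>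
  increases because its derivative is \<open>ln (t + 1) - ln t\<close>.\<close>

lemma radius_bound_power_le:
  assumes u: "0 < u" "u < 1" and d: "d \<ge> 1" and N: "u * real (N + d) \<le> real N"
  shows "radius_bound u ^ d * (real N ^ N * real d ^ d) \<le> real (N + d) ^ (N + d)"
proof -
  define q where "q = (\<lambda>t::real. (t + 1) * ln (t + 1) - t * ln t)"
  define t where "t = real N / real d"
  define t0 where "t0 = u / (1 - u)"
  have "0 < u * real (N + d)" using u d by (intro mult_pos_pos) auto
  with N have N0: "real N > 0" by linarith
  have t0: "t0 > 0" "t0 \<le> t" and t: "t > 0"
    using u d N N0 by (auto simp: t0_def t_def field_simps)
  have "q t0 \<le> q t"
  proof (rule DERIV_nonneg_imp_nondecreasing[OF t0(2)])
    fix x assume "t0 \<le> x" "x \<le> t"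
    then have x: "x > 0" using t0 by linarith
    have "(q has_real_derivative (ln (x + 1) - ln x)) (at x)"
      unfolding q_def using x by (auto intro!: derivative_eq_intros simp: field_simps)
    moreover have "ln (x + 1) - ln x \<ge> 0" using x by simp
    ultimately show "\<exists>y. (q has_real_derivative y) (at x) \<and> y \<ge> 0" by blast
  qed
  moreover have "ln (radius_bound u) = q t0"
  proof -
    have "t0 + 1 = 1 / (1 - u)" using u by (simp add: t0_def field_simps)
    moreover have "ln (1 / (1 - u)) = - ln (1 - u)" "ln t0 = ln u - ln (1 - u)"
      using u by (simp_all add: t0_def ln_div)
    ultimately have "q t0 = - ln (1 - u) / (1 - u) - u / (1 - u) * (ln u - ln (1 - u))"
      by (simp add: q_def t0_def)
    also have "\<dots> = u / (u - 1) * ln u - ln (1 - u)"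
      using u by (simp add: divide_simps) (simp add: algebra_simps)
    also have "\<dots> = ln (radius_bound u)"
      using u by (simp add: radius_bound_def ln_div ln_powr)
    finally show ?thesis by simp
  qed
  ultimately have "real d * ln (radius_bound u) \<le> real d * q t"
    by (intro mult_left_mono) auto
  \<comment> \<open>In the expansion, the terms with \<open>ln d\<close> add up to
    \<open>- (N + d) ln d + N ln d = - d ln d\<close>.\<close>
  also have "real d * q t = real (N + d) * ln (real (N + d)) - real N * ln (real N) - real d * ln (real d)"
  proof -
    have "t + 1 = real (N + d) / real d" using d by (simp add: t_def field_simps)
    then have ln_eq: "ln (t + 1) = ln (real (N + d)) - ln (real d)" "ln t = ln (real N) - ln (real d)"
      using d N0 by (simp_all add: t_def ln_div)
    have "real d * q t = real d * (t + 1) * ln (t + 1) - real d * t * ln t"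
      by (simp add: q_def algebra_simps)
    then have "real d * q t = real d * (t + 1) * (ln (real (N + d)) - ln (real d))
        - real d * t * (ln (real N) - ln (real d))"
      by (simp only: ln_eq)
    moreover have t_eq: "real d * t = real N" "real d * (t + 1) = real (N + d)"
      using d by (simp_all add: t_def field_simps)
    ultimately have "real d * q t = real (N + d) * (ln (real (N + d)) - ln (real d))
        - real N * (ln (real N) - ln (real d))"
      by (simp only: t_eq)
    then show ?thesis by (simp add: algebra_simps)
  qed
  finally have "ln (radius_bound u ^ d * (real N ^ N * real d ^ d)) \<le> ln (real (N + d) ^ (N + d))"
    using N0 d radius_bound_pos[OF u] by (simp add: ln_mult ln_realpow)
  then show ?thesis
    using N0 d radius_bound_pos[OF u] by (subst (asm) ln_le_cancel_iff) auto
qed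

lemma radius_bound_fact_le:
  assumes u: "0 < u" "u < 1" and d: "d \<ge> 1" and N: "u * real (N + d) \<le> real N"
  shows "radius_bound u ^ d * (fact d * fact N) \<le> exp 1 * real d * fact (N + d)"
proof -
  let ?K = "radius_bound u ^ d" and ?N = "real N ^ N" and ?d = "real d ^ d" and ?n = "real (N + d) ^ (N + d)"
  have "0 < u * real (N + d)" using u d by (intro mult_pos_pos) auto
  with N have N0: "N \<ge> 1" by simp
  \<comment> \<open>The factor \<open>exp d * N^N * d^d\<close> is inserted to fit the three
    preceding estimates and is cancelled at the end.\<close>
  have "?K * (fact d * fact N) * (exp (real d) * (?N * ?d))
      = (?K * (?N * ?d)) * fact N * (fact d * exp (real d))"
    by simp
  also have "\<dots> \<le> ?n * fact N * (exp 1 * real d * ?d)"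
    by (intro mult_mono[OF mult_right_mono[OF radius_bound_power_le[OF assms]] fact_times_exp_le[OF d]]) auto
  also have "\<dots> \<le> (exp (real d) * ?N * fact (N + d)) * (exp 1 * real d * ?d)"
    using power_self_times_fact_le[OF N0] by (intro mult_right_mono) auto
  also have "\<dots> = (exp 1 * real d * fact (N + d)) * (exp (real d) * (?N * ?d))"
    by simp
  finally show ?thesis
    using N0 d by (subst (asm) mult_le_cancel_right_pos) auto
qed

lemma fact_add_ge:
  assumes "d \<ge> 1"
  shows "real (N + 1) * (fact d * fact N) \<le> fact (N + d)"
  using assms
proof (induction d rule: dec_induct)
  case (step d)
  have "real (N + 1) * (fact (Suc d) * fact N) = real (Suc d) * (real (N + 1) * (fact d * fact N))"
    by simp
  also have "\<dots> \<le> real (Suc (N + d)) * fact (N + d)"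
    using step.IH by (intro mult_mono) auto
  finally show ?case by simp
qed simp

text \<open>One threshold \<open>N0\<close> has to serve all \<open>d\<close>, which is why large
  and small \<open>d\<close> are treated separately. The polynomial and the factorial are taken at
  \<open>d + 1\<close> because the passage from \<open>n p + 1\<close> to
  \<open>n (p + 1) + 1\<close> uses the coefficient bound of index \<open>d + 1\<close>.\<close>

lemma fact_growth:
  assumes u: "0 < u" "u < 1" and th: "th > 0" "1 < th * radius_bound u"
  shows "\<exists>N0. \<forall>N\<ge>N0. \<forall>d\<ge>1. u * real (N + d) \<le> real N \<longrightarrow>
           (2 * (real d + 1)\<^sup>2 + 1) / 3 * fact (d + 1) * fact N \<le> th ^ d * fact (N + d)"
proof -
  define Q where "Q = (\<lambda>d::nat. (2 * (real d + 1)\<^sup>2 + 1) / 3 * (real d + 1))"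
  have Q0: "Q d \<ge> 0" for d by (simp add: Q_def)
  define x where "x = th * radius_bound u"
  have "x > 1" using th by (simp add: x_def)
  then have "(\<lambda>d. Q d * (exp 1 * real d) / x ^ d) \<longlonglongrightarrow> 0"
    unfolding Q_def by real_asymp
  then have "eventually (\<lambda>d. Q d * (exp 1 * real d) / x ^ d < 1) sequentially"
    by (rule order_tendstoD) simp
  then obtain d0 where d0: "\<And>d. d \<ge> d0 \<Longrightarrow> Q d * (exp 1 * real d) / x ^ d < 1"
    by (auto simp: eventually_sequentially)
  \<comment> \<open>Only finitely many \<open>d\<close> remain; for each, the left side is constant
    in \<open>N\<close>, so a common threshold exists.\<close>
  have "\<forall>d\<in>{..<d0}. eventually (\<lambda>N. Q d / th ^ d \<le> real (N + 1)) sequentially"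
    by (intro ballI) real_asymp
  then have "eventually (\<lambda>N. \<forall>d\<in>{..<d0}. Q d / th ^ d \<le> real (N + 1)) sequentially"
    by (intro eventually_ball_finite) auto
  then obtain N0 where N0: "\<And>N d. N \<ge> N0 \<Longrightarrow> d < d0 \<Longrightarrow> Q d / th ^ d \<le> real (N + 1)"
    by (auto simp: eventually_sequentially)
  show ?thesis
  proof (intro exI allI impI)
    fix N d :: nat assume N: "N \<ge> N0" and d: "d \<ge> 1" and *: "u * real (N + d) \<le> real N"
    have "Q d * (fact d * fact N) \<le> th ^ d * fact (N + d)"
    proof (cases "d < d0")
      case True
      from N0[OF N True] have "Q d \<le> th ^ d * real (N + 1)"
        using th by (simp add: field_simps)
      then have "Q d * (fact d * fact N) \<le> th ^ d * real (N + 1) * (fact d * fact N)"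
        by (intro mult_right_mono) auto
      also have "\<dots> \<le> th ^ d * fact (N + d)"
        using mult_left_mono[OF fact_add_ge[OF d, of N], of "th ^ d"] th by simp
      finally show ?thesis .
    next
      case False
      have K: "radius_bound u ^ d > 0" using radius_bound_pos[OF u] by simp
      have "x ^ d > 0" using \<open>x > 1\<close> by simp
      with d0[of d] False have "Q d * (exp 1 * real d) \<le> x ^ d"
        by (simp add: divide_less_eq)
      then have Q_le: "Q d * (exp 1 * real d) \<le> th ^ d * radius_bound u ^ d"
        by (simp add: x_def power_mult_distrib)
      have "radius_bound u ^ d * (Q d * (fact d * fact N)) = Q d * (radius_bound u ^ d * (fact d * fact N))"
        by simp
      also have "\<dots> \<le> Q d * (exp 1 * real d * fact (N + d))"
        by (intro mult_left_mono radius_bound_fact_le u d * Q0)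
      also have "\<dots> = Q d * (exp 1 * real d) * fact (N + d)"
        by simp
      also have "\<dots> \<le> th ^ d * radius_bound u ^ d * fact (N + d)"
        using Q_le by (intro mult_right_mono) auto
      also have "\<dots> = radius_bound u ^ d * (th ^ d * fact (N + d))"
        by simp
      finally have "radius_bound u ^ d * (Q d * (fact d * fact N)) \<le> radius_bound u ^ d * (th ^ d * fact (N + d))" .
      then show ?thesis using K by simp
    qed
    then show "(2 * (real d + 1)\<^sup>2 + 1) / 3 * fact (d + 1) * fact N \<le> th ^ d * fact (N + d)"
      by (simp add: Q_def algebra_simps)
  qed
qed

section \<open>Geometric growth of the coefficients and the radius of convergence\<close>

text \<open>The quantity \<open>T p = (n p + 1) M (n p + 1)\<close> gains at most
  \<open>th^(n (p + 1) - n p)\<close> per step, so it is bounded by a multiple of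
  \<open>th^(n p)\<close>. Indices between \<open>n p\<close> and \<open>n (p + 1)\<close> are then
  reached by a single application of \<open>rec\<close>.\<close>

lemma coeff_growth:
  fixes M :: "nat \<Rightarrow> real" and n :: "nat \<Rightarrow> nat"
  assumes M: "\<And>m. M m \<ge> 0"
    and rec: "\<And>p k. p \<ge> 1 \<Longrightarrow> k \<ge> 1 \<Longrightarrow>
      fact (n p + k) * M (n p + k) \<le> (2 * real k ^ 2 + 1) / 3 * fact k * (fact (n p + 1) * M (n p + 1))"
    and n: "strict_mono_on {1..} n"
    and u: "0 < u" "u < 1" and ev: "eventually (\<lambda>p. u * real (n (p + 1)) \<le> real (n p)) sequentially"
    and th: "th > 0" "1 < th * radius_bound u"
  shows "\<exists>C. eventually (\<lambda>m. M m \<le> C * th ^ m) sequentially"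
proof -
  obtain N0 where N0: "\<And>N d. N \<ge> N0 \<Longrightarrow> d \<ge> 1 \<Longrightarrow> u * real (N + d) \<le> real N \<Longrightarrow>
           (2 * (real d + 1)\<^sup>2 + 1) / 3 * fact (d + 1) * fact N \<le> th ^ d * fact (N + d)"
    using fact_growth[OF u th] by blast
  have less: "n p < n (p + 1)" if "p \<ge> 1" for p
    using n that by (auto simp: strict_mono_on_def)
  have ge: "p \<le> n (p + 1)" for p
  proof (induction p)
    case (Suc p)
    then show ?case using less[of "p + 1"] by simp
  qed simp
  obtain p1 where p1: "\<And>p. p \<ge> p1 \<Longrightarrow> u * real (n (p + 1)) \<le> real (n p)"
    using ev by (auto simp: eventually_sequentially)
  \<comment> \<open>\<open>Suc p1\<close> secures \<open>p >= 1\<close> and the ratio condition;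
    \<open>Suc N0\<close> secures \<open>n p >= p - 1 >= N0\<close>.\<close>
  define p0 where "p0 = max (Suc p1) (Suc N0)"
  have p0: "p \<ge> 1" "p \<ge> p1" "n p \<ge> N0" if "p \<ge> p0" for p
    using that ge[of "p - 1"] by (auto simp: p0_def)
  define T where "T = (\<lambda>p. fact (n p + 1) * M (n p + 1) / fact (n p))"
  have T: "T p \<ge> 0" for p using M by (simp add: T_def)
  \<comment> \<open>The ratio condition for the whole gap implies it for every shorter
    \<open>k\<close>. With \<open>k + 1\<close> on the left, the estimate serves both the step to
    \<open>p + 1\<close> and, by monotonicity in \<open>k\<close>, the indices inside the
    gap.\<close>
  have est: "(2 * (real k + 1)\<^sup>2 + 1) / 3 * fact (k + 1) * (fact (n p + 1) * M (n p + 1))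
      \<le> th ^ k * fact (n p + k) * T p"
    if p: "p \<ge> p0" and k: "k \<ge> 1" "n p + k \<le> n (p + 1)" for p k
  proof -
    have "u * real (n p + k) \<le> u * real (n (p + 1))"
      using k u by (intro mult_left_mono) auto
    also have "\<dots> \<le> real (n p)" using p1 p0 p by auto
    finally have "(2 * (real k + 1)\<^sup>2 + 1) / 3 * fact (k + 1) * fact (n p) * T p \<le> th ^ k * fact (n p + k) * T p"
      using N0 p0 p k T by (intro mult_right_mono) auto
    then show ?thesis by (simp add: T_def del: fact_Suc)
  qed
  have Tstep: "T (p + 1) \<le> th ^ (n (p + 1) - n p) * T p" if p: "p \<ge> p0" for p
  proof -
    define d where "d = n (p + 1) - n p"
    have d: "d \<ge> 1" "n (p + 1) = n p + d"
      using less[of p] p0(1)[OF p] by (simp_all add: d_def)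
    have "fact (n (p + 1)) * T (p + 1) = fact (n p + (d + 1)) * M (n p + (d + 1))"
      using d by (simp add: T_def del: fact_Suc)
    also have "\<dots> \<le> (2 * real (d + 1) ^ 2 + 1) / 3 * fact (d + 1) * (fact (n p + 1) * M (n p + 1))"
      by (rule rec) (use p0 p in auto)
    also have "\<dots> \<le> th ^ d * fact (n p + d) * T p"
      using est[OF p d(1)] d(2) by (simp add: add.commute del: fact_Suc)
    finally have "fact (n (p + 1)) * T (p + 1) \<le> fact (n (p + 1)) * (th ^ d * T p)"
      using d by (simp add: mult_ac)
    then show ?thesis by (simp add: d_def)
  qed
  define C where "C = T p0 / th ^ n p0"
  have TC: "T p \<le> C * th ^ n p" if "p \<ge> p0" for p
    using that
  proof (induction p rule: dec_induct)
    case base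
    then show ?case using th by (simp add: C_def)
  next
    case (step p)
    have "T (p + 1) \<le> th ^ (n (p + 1) - n p) * T p" using Tstep step.hyps by simp
    also have "\<dots> \<le> th ^ (n (p + 1) - n p) * (C * th ^ n p)"
      using step.IH th by (intro mult_left_mono) auto
    also have "\<dots> = C * th ^ n (p + 1)"
      using less[of p] p0[OF step.hyps(1)] by (simp flip: power_add)
    finally show ?case by simp
  qed
  have "M m \<le> C * th ^ m" if m: "m > n p0" for m
  proof -
    \<comment> \<open>The least such \<open>p'\<close> is positive since \<open>m > n p0\<close>;
      its predecessor gives the \<open>p\<close> with \<open>n p < m <= n (p + 1)\<close>.\<close>
    define p' where "p' = (LEAST p. m \<le> n (p0 + p))"
    have "m \<le> n (p0 + (m + 1))" using ge[of "p0 + m"] by simp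
    then have p': "m \<le> n (p0 + p')" unfolding p'_def by (rule LeastI)
    with m obtain j where j: "p' = Suc j" by (cases p') auto
    have "\<not> m \<le> n (p0 + j)" using not_less_Least[of j "\<lambda>p. m \<le> n (p0 + p)"] j by (simp add: p'_def)
    define p where "p = p0 + j"
    define k where "k = m - n p"
    have p: "p \<ge> p0" and k: "k \<ge> 1" "n p + k \<le> n (p + 1)" and mk: "m = n p + k"
      using p' \<open>\<not> m \<le> n (p0 + j)\<close> by (auto simp: p_def k_def j)
    have "fact m * M m \<le> (2 * real k ^ 2 + 1) / 3 * fact k * (fact (n p + 1) * M (n p + 1))"
      unfolding mk by (rule rec) (use p0 p k in auto)
    also have "\<dots> \<le> (2 * (real k + 1)\<^sup>2 + 1) / 3 * fact (k + 1) * (fact (n p + 1) * M (n p + 1))"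
      using M by (intro mult_right_mono mult_mono divide_right_mono add_right_mono mult_left_mono power_mono fact_mono) auto
    also have "\<dots> \<le> th ^ k * fact m * T p" unfolding mk by (rule est) (use p k in auto)
    also have "\<dots> \<le> th ^ k * fact m * (C * th ^ n p)"
      using TC[OF p] th by (intro mult_left_mono) auto
    also have "\<dots> = fact m * (C * th ^ m)" by (simp add: mk power_add)
    finally show ?thesis by simp
  qed
  then show ?thesis unfolding eventually_sequentially by (metis Suc_le_eq)
qed

text \<open>Cauchy-Hadamard by comparison: for \<open>r < s < K\<close> the base
  \<open>th = 1 / s\<close> exceeds \<open>1 / K\<close>, and the terms at \<open>r\<close> are
  dominated by a geometric series of ratio \<open>r / s\<close>.\<close>

lemma conv_radius_ge_geometric:
  fixes c :: "nat \<Rightarrow> complex"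
  assumes K: "K > 0"
    and "\<And>th. th > 0 \<Longrightarrow> 1 < th * K \<Longrightarrow> \<exists>C. eventually (\<lambda>m. cmod (c m) \<le> C * th ^ m) sequentially"
  shows "conv_radius c \<ge> ereal K"
proof (rule conv_radius_geI_ex')
  fix r assume r: "0 < r" "ereal r < ereal K"
  then obtain s where s: "r < s" "s < K" using dense by auto
  with r K have "1 / s > 0" "1 < 1 / s * K" by (auto simp: field_simps)
  then obtain C where C: "eventually (\<lambda>m. cmod (c m) \<le> C * (1 / s) ^ m) sequentially"
    using assms(2) by blast
  have "summable (\<lambda>m. C * (r / s) ^ m)"
    using r s by (intro summable_mult summable_geometric) auto
  moreover have "eventually (\<lambda>m. norm (c m * of_real r ^ m) \<le> C * (r / s) ^ m) sequentially"
    using C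
  proof eventually_elim
    case (elim m)
    then have "cmod (c m) * r ^ m \<le> C * (1 / s) ^ m * r ^ m"
      using r by (intro mult_right_mono) auto
    then show ?case using r by (simp add: norm_mult norm_power power_divide)
  qed
  ultimately show "summable (\<lambda>m. c m * of_real r ^ m)"
    by (rule summable_comparison_test_ev[rotated])
qed

section \<open>The symmetric coefficient inequality and the entire extension\<close>

text \<open>The normalising coefficient is the larger one of index \<open>N + 1\<close>, so both
  cases give the same bound in terms of the maximum. Conjugation reduces the second case to the
  first with \<open>h\<close> and \<open>g\<close> exchanged.\<close>

lemma harmonic_coeff_max_bound:
  assumes dec: "harmonic_decomp unit_disc f h g"
    and h: "\<And>z. z \<in> unit_disc \<Longrightarrow> (\<lambda>k. a k * z ^ k) sums h z"
    and g: "\<And>z. z \<in> unit_disc \<Longrightarrow> (\<lambda>k. b k * z ^ k) sums g z"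
    and ge: "cmod (a (N + 1)) \<ge> cmod (b (N + 1)) \<Longrightarrow>
           (\<lambda>z. (harmonic_deriv h g N z - fact N * a N - fact N * cnj (b N))
                / (fact (N + 1) * a (N + 1))) \<in> S_H_c"
    and le: "cmod (a (N + 1)) \<le> cmod (b (N + 1)) \<Longrightarrow>
           (\<lambda>z. (cnj (harmonic_deriv h g N z) - fact N * cnj (a N) - fact N * b N)
                / (fact (N + 1) * b (N + 1))) \<in> S_H_c"
    and k: "k \<ge> 1"
  shows "fact (N + k) * max (cmod (a (N + k))) (cmod (b (N + k)))
    \<le> (2 * real k ^ 2 + 1) / 3 * fact k * (fact (N + 1) * max (cmod (a (N + 1))) (cmod (b (N + 1))))"
\<comment> \<open>\<open>S_H_c\<close> bounds coefficients only from index 2 on; for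
  \<open>k = 1\<close> the factor \<open>(2 k^2 + 1) / 3 * k!\<close> is 1 and equality
  holds.\<close>
proof (cases "k = 1")
  case False
  with k have k2: "k \<ge> 2" by simp
  have hol: "h holomorphic_on unit_disc" "g holomorphic_on unit_disc"
    using dec by (auto simp: harmonic_decomp_def)
  show ?thesis
  proof (cases "cmod (a (N + 1)) \<ge> cmod (b (N + 1))")
    case True
    have "(\<lambda>z. ((deriv ^^ N) h z + cnj ((deriv ^^ N) g z) - (fact N * a N + fact N * cnj (b N)))
                / (fact (N + 1) * a (N + 1))) \<in> S_H_c"
      using ge[OF True] by (simp only: harmonic_deriv_def diff_diff_eq)
    from S_H_c_coeff_bound[OF hol h g this k2] True show ?thesis
      by (simp add: max_def del: fact_Suc)
  next
    case False
    then have *: "cmod (a (N + 1)) \<le> cmod (b (N + 1))" by simp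
    have "(\<lambda>z. ((deriv ^^ N) g z + cnj ((deriv ^^ N) h z) - (fact N * cnj (a N) + fact N * b N))
                / (fact (N + 1) * b (N + 1))) \<in> S_H_c"
      using le[OF *]
      by (simp only: harmonic_deriv_def diff_diff_eq complex_cnj_add complex_cnj_cnj add.commute[of "cnj ((deriv ^^ N) h _)"])
    from S_H_c_coeff_bound[OF hol(2,1) g h this k2] * show ?thesis
      by (simp add: max_def del: fact_Suc)
  qed
qed simp

lemma harmonic_entire_if_radius_infinite:
  assumes dec: "harmonic_decomp unit_disc f h g"
    and h: "\<And>z. z \<in> unit_disc \<Longrightarrow> (\<lambda>k. a k * z ^ k) sums h z"
    and g: "\<And>z. z \<in> unit_disc \<Longrightarrow> (\<lambda>k. b k * z ^ k) sums g z"
    and R: "harmonic_radius a b = \<infinity>"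
  shows "harmonic_entire f"
proof -
  define H where "H = eval_fps (Abs_fps a)"
  define G where "G = eval_fps (Abs_fps b)"
  have cr: "conv_radius a = \<infinity>" "conv_radius b = \<infinity>"
    using R by (auto simp: harmonic_radius_def min_def split: if_splits)
  have "H holomorphic_on UNIV" "G holomorphic_on UNIV"
    unfolding H_def G_def by (auto intro!: holomorphic_on_eval_fps simp: fps_conv_radius_def cr)
  moreover have "H z = h z" "G z = g z" if "z \<in> unit_disc" for z
    using h[OF that] g[OF that] by (auto simp: H_def G_def eval_fps_def sums_iff)
  ultimately show ?thesis
    using dec unfolding harmonic_entire_def harmonic_fun_on_def harmonic_decomp_def
    by (intro exI[of _ "\<lambda>z. H z + cnj (G z)"]) auto
qed

section \<open>Passage to the lower limit and the three cases\<close>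

theorem theorem7:
  fixes f h g :: "complex \<Rightarrow> complex"
    and a b :: "nat \<Rightarrow> complex"
    and n :: "nat \<Rightarrow> nat"
    and lam :: real
  assumes "harmonic_decomp unit_disc f h g"
    and "\<And>z. z \<in> unit_disc \<Longrightarrow> (\<lambda>k. a k * z ^ k) sums h z"
    and "\<And>z. z \<in> unit_disc \<Longrightarrow> (\<lambda>k. b k * z ^ k) sums g z"
    and "b 0 = 0"
    and "strict_mono_on {1..} n"
    and "\<And>p. p \<ge> 1 \<Longrightarrow> cmod (a (n p + 1)) \<ge> cmod (b (n p + 1)) \<Longrightarrow>
           (\<lambda>z. (harmonic_deriv h g (n p) z - fact (n p) * a (n p) - fact (n p) * cnj (b (n p)))
                / (fact (n p + 1) * a (n p + 1))) \<in> S_H_c"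
    and "\<And>p. p \<ge> 1 \<Longrightarrow> cmod (a (n p + 1)) \<le> cmod (b (n p + 1)) \<Longrightarrow>
           (\<lambda>z. (cnj (harmonic_deriv h g (n p) z) - fact (n p) * cnj (a (n p)) - fact (n p) * b (n p))
                / (fact (n p + 1) * b (n p + 1))) \<in> S_H_c"
    and "ereal lam = liminf (\<lambda>p. ereal (real (n p) / real (n (p + 1))))"
  shows "(lam = 1 \<longrightarrow> harmonic_radius a b = \<infinity> \<and> harmonic_entire f)
       \<and> (0 < lam \<and> lam < 1 \<longrightarrow>
            harmonic_radius a b \<ge> ereal (lam powr (lam / (lam - 1)) / (1 - lam)))
       \<and> (lam = 0 \<longrightarrow> harmonic_radius a b \<ge> 1)"
proof -
  define M where "M = (\<lambda>m. max (cmod (a m)) (cmod (b m)))"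
  have M: "M m \<ge> 0" for m by (simp add: M_def le_max_iff_disj)
  have rec: "fact (n p + k) * M (n p + k) \<le> (2 * real k ^ 2 + 1) / 3 * fact k * (fact (n p + 1) * M (n p + 1))"
    if "p \<ge> 1" "k \<ge> 1" for p k
    unfolding M_def by (rule harmonic_coeff_max_bound[OF assms(1-3) assms(6,7)[OF that(1)] that(2)])
  have radius: "harmonic_radius a b \<ge> ereal (radius_bound u)" if u: "0 < u" "u < 1" "u < lam" for u
  proof -
    have "eventually (\<lambda>p. ereal u < ereal (real (n p) / real (n (p + 1)))) sequentially"
      using u(3) assms(8) by (intro less_LiminfD) (metis less_ereal.simps(1))
    then have ev: "eventually (\<lambda>p. u * real (n (p + 1)) \<le> real (n p)) sequentially"
    proof eventually_elim
      case (elim p)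
      then have "u < real (n p) / real (n (p + 1))" by simp
      with u(1) show ?case by (cases "n (p + 1) = 0") (simp_all add: field_simps)
    qed
    have *: "\<exists>C. eventually (\<lambda>m. M m \<le> C * th ^ m) sequentially"
      if "th > 0" "1 < th * radius_bound u" for th
      using coeff_growth[OF M rec assms(5) u(1,2) ev that] .
    \<comment> \<open>Stated for any \<open>c\<close> dominated by \<open>M\<close>, so that it
      covers both \<open>a\<close> and \<open>b\<close>.\<close>
    have "conv_radius c \<ge> ereal (radius_bound u)" if c: "\<And>m. cmod (c m) \<le> M m" for c
    proof (rule conv_radius_ge_geometric[OF radius_bound_pos[OF u(1,2)]])
      fix th assume "th > 0" "1 < th * radius_bound u"
      from *[OF this] obtain C where "eventually (\<lambda>m. M m \<le> C * th ^ m) sequentially" ..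
      then have "eventually (\<lambda>m. cmod (c m) \<le> C * th ^ m) sequentially"
        by eventually_elim (use c order_trans in blast)
      then show "\<exists>C. eventually (\<lambda>m. cmod (c m) \<le> C * th ^ m) sequentially" ..
    qed
    then show ?thesis by (simp add: harmonic_radius_def M_def)
  qed
  have "harmonic_radius a b = \<infinity>" if "lam = 1"
  proof (rule ereal_top)
    fix B :: real
    \<comment> \<open>This makes \<open>1 / (1 - u) = \<bar>B\<bar> + 2\<close>, and the summand 2
      keeps \<open>u\<close> positive. The remaining factor of \<open>radius_bound u\<close> is at
      least 1, as its base is below 1 and its exponent negative.\<close>
    define u where "u = 1 - 1 / (\<bar>B\<bar> + 2)"
    have u: "0 < u" "u < 1" by (simp_all add: u_def field_simps)
    have "1 \<le> u powr (u / (u - 1))"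
      using u powr_mono'[of "u / (u - 1)" 0 u] by (simp add: divide_nonneg_neg divide_nonneg_nonpos)
    then have "1 / (1 - u) \<le> radius_bound u"
      using u by (simp add: radius_bound_def divide_right_mono)
    moreover have "1 / (1 - u) = \<bar>B\<bar> + 2" by (simp add: u_def)
    ultimately have "ereal B \<le> ereal (radius_bound u)" by simp
    also have "\<dots> \<le> harmonic_radius a b" using radius u that by simp
    finally show "harmonic_radius a b \<ge> ereal B" .
  qed
  moreover have "harmonic_radius a b \<ge> ereal (radius_bound lam)" if lam: "0 < lam" "lam < 1"
  proof -
    \<comment> \<open>The bound is known only for \<open>u < lam\<close>; it passes to
      \<open>lam\<close> as a limit from the left.\<close>
    have "continuous (at lam) radius_bound"
      unfolding radius_bound_def using lam by (auto intro!: continuous_intros)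
    then have "(radius_bound \<longlongrightarrow> radius_bound lam) (at_left lam)"
      using tendsto_mono[OF at_le[of "{..<lam}" UNIV]] by (auto simp: continuous_at)
    then have lim: "((\<lambda>u. ereal (radius_bound u)) \<longlongrightarrow> ereal (radius_bound lam)) (at_left lam)"
      by simp
    have "eventually (\<lambda>u. u \<in> {0<..<lam}) (at_left lam)"
      using lam by (intro eventually_at_leftI[of 0]) auto
    then have "eventually (\<lambda>u. ereal (radius_bound u) \<le> harmonic_radius a b) (at_left lam)"
      by eventually_elim (use lam radius in auto)
    then show ?thesis by (intro tendsto_upperbound[OF lim]) auto
  qed
  \<comment> \<open>For \<open>lam = 0\<close> there is no \<open>u\<close> with
    \<open>0 < u < lam\<close>; the bound 1 comes from convergence of both series in the unit
    disc.\<close>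
  moreover have "harmonic_radius a b \<ge> 1"
  proof -
    have "conv_radius c \<ge> 1" if c: "\<And>z. z \<in> unit_disc \<Longrightarrow> (\<lambda>k. c k * z ^ k) sums s z" for c :: "nat \<Rightarrow> complex" and s
    proof (rule conv_radius_geI_ex')
      fix r assume "0 < r" "ereal r < 1"
      then have "of_real r \<in> unit_disc" by simp
      from c[OF this] show "summable (\<lambda>k. c k * of_real r ^ k)" by (rule sums_summable)
    qed
    from this[OF assms(2)] this[OF assms(3)] show ?thesis by (simp add: harmonic_radius_def)
  qed
  ultimately show ?thesis
    using harmonic_entire_if_radius_infinite[OF assms(1-3)] by (simp add: radius_bound_def)
qed

end
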